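(* For all $M,n\in\mathbb N$ with $M>1$ or $n>1$, $$A(n,M)=\varphi(M)\sum_{d\mid M} A(n-1,d)\left(\frac{M}{d}\right)^{n-1},$$ where the sum runs over the positive divisors $d$ of $M$.
   Context: Let $\chi:\mathbb Q\to\mathbb Q$ be defined by $\chi(x)=x\lceil x\rceil$, where $\lceil x\rceil$ is the smallest integer greater than or equal to $x$. For $x\in\mathbb Q$, $\mathrm{ord}(x)=\min\{k\in\mathbb N_0:\chi^k(x)\in\mathbb Z\}$ if this set is nonempty, and $\mathrm{ord}(x)=\infty$ otherwise ($\mathbb N=\{1,2,\dots\}$, $\mathbb N_0=\mathbb N\cup\{0\}$). For $n\in\mathbb N_0$ and $M\in\mathbb N$, let $\mathcal A_{n,M}=\{a\in\mathbb Z:\gcd(a,M)=1,\ \mathrm{ord}(a/M)=n\}$; this set is a union of congruence classes modulo $M^{n+1}$, and $A(n,M)$ denotes the number of congruence classes modulo $M^{n+1}$ contained in $\mathcal A_{n,M}$ (so $A(0,1)=1$, $A(n,1)=0$ for $n\ge1$, $A(0,M)=0$ for $M>1$). $\varphi$ is Euler's totient function. *)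

theory Defs
  imports "HOL-Number_Theory.Number_Theory" "HOL-Library.Extended_Nat"
begin

definition chi :: "rat \<Rightarrow> rat" where
  "chi x = x * of_int \<lceil>x\<rceil>"

definition chi_ord :: "rat \<Rightarrow> enat" where
  "chi_ord x =
     (if \<exists>k. (chi ^^ k) x \<in> \<int> then enat (LEAST k. (chi ^^ k) x \<in> \<int>) else \<infinity>)"

definition A_set :: "nat \<Rightarrow> nat \<Rightarrow> int set" where
  "A_set n M = {a. gcd a (int M) = 1 \<and> chi_ord (of_int a / of_nat M) = enat n}"

definition cong_classes :: "int \<Rightarrow> int set set" where
  "cong_classes m = UNIV // {(a, b). [a = b] (mod m)}"

definition A_count :: "nat \<Rightarrow> nat \<Rightarrow> nat" where
  "A_count n M = card {C \<in> cong_classes (int M ^ (n + 1)). C \<subseteq> A_set n M}"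

end

theory Submission
  imports Defs
begin

text \<open>
  Drop the coprimality condition and let \<open>B(n,M)\<close> be the set of all numerators \<open>a\<close> with
  \<open>ord(a/M) = n\<close>. Since \<open>\<chi>(a/M) = a\<lceil>a/M\<rceil>/M\<close>, the step from \<open>n\<close> to \<open>n + 1\<close> can be made
  without reducing fractions: for \<open>0 < s < M\<close> the numerator \<open>c M + s\<close> lies in \<open>B(n+1,M)\<close> iff
  \<open>(c M + s)(c + 1)\<close> lies in \<open>B(n,M)\<close>. If \<open>s\<close> is a unit modulo \<open>M\<close>, this quadratic polynomial
  in \<open>c\<close> permutes the residues modulo every power of \<open>M\<close>, so each of the \<open>\<phi>(M)\<close> units \<open>s\<close>
  contributes to \<open>A(n+1,M)\<close> the number of classes modulo \<open>M\<^bsup>n+1\<^esup>\<close> in \<open>B(n,M)\<close>. Reducing fractions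
  writes \<open>B(n,M)\<close> as the disjoint union of the sets \<open>(M/d) \<A>\<^bsub>n,d\<^esub>\<close> for \<open>d\<close> dividing \<open>M\<close>, which
  gives the sum over the divisors.
\<close>

subsection \<open>Periodic sets of integers\<close>

definition periodic_mod :: "nat \<Rightarrow> int set \<Rightarrow> bool" where
  "periodic_mod N S \<longleftrightarrow> (\<forall>x y. [x = y] (mod int N) \<longrightarrow> (x \<in> S \<longleftrightarrow> y \<in> S))"

definition residue_count :: "nat \<Rightarrow> int set \<Rightarrow> nat" where
  "residue_count N S = card {j. j < N \<and> int j \<in> S}"

lemma periodic_modI:
  "(\<And>x y. [x = y] (mod int N) \<Longrightarrow> x \<in> S \<longleftrightarrow> y \<in> S) \<Longrightarrow> periodic_mod N S"
  unfolding periodic_mod_def by blast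

lemma periodic_modD: "periodic_mod N S \<Longrightarrow> [x = y] (mod int N) \<Longrightarrow> x \<in> S \<longleftrightarrow> y \<in> S"
  unfolding periodic_mod_def by blast

lemma periodic_mod_Int: "periodic_mod N S \<Longrightarrow> periodic_mod N T \<Longrightarrow> periodic_mod N (S \<inter> T)"
  unfolding periodic_mod_def by blast

lemma periodic_mod_coprime: "M dvd N \<Longrightarrow> periodic_mod N {a. coprime a (int M)}"
  unfolding periodic_mod_def mem_Collect_eq
  by (meson cong_dvd_modulus coprime_cong_cong_left of_nat_dvd_iff)

lemma residue_count_eq_sum: "residue_count N S = (\<Sum>j<N. of_bool (int j \<in> S))"
  by (simp add: residue_count_def Int_def)

lemma residue_count_mult:
  "residue_count (M * N) S = (\<Sum>s<M. residue_count N {c. c * int M + int s \<in> S})"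
proof -
  define f :: "nat \<Rightarrow> nat" where "f = (\<lambda>j. of_bool (int j \<in> S))"
  have "residue_count (M * N) S = sum f {..<N * M}"
    by (simp only: residue_count_eq_sum f_def mult.commute[of M])
  also have "\<dots> = (\<Sum>c<N. sum f {c * M..<c * M + M})"
    by (rule sum.nat_group[symmetric])
  also have "\<dots> = (\<Sum>c<N. \<Sum>s<M. f (c * M + s))"
    by (simp add: sum.atLeastLessThan_shift_0 atLeast0LessThan)
  also have "\<dots> = (\<Sum>s<M. \<Sum>c<N. f (c * M + s))"
    by (rule sum.swap)
  finally show ?thesis
    by (simp add: residue_count_eq_sum f_def del: sum_of_bool_eq)
qed

lemma residue_count_periodic_mult:
  assumes "periodic_mod N S"
  shows "residue_count (N * k) S = k * residue_count N S"
proof -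
  have "c * int N + int s \<in> S \<longleftrightarrow> int s \<in> S" for c s
    by (rule periodic_modD[OF assms]) (simp add: cong_def)
  then have "residue_count k {c. c * int N + int s \<in> S} = k * of_bool (int s \<in> S)" for s
    by (simp add: residue_count_def)
  then show ?thesis
    by (simp only: residue_count_mult residue_count_eq_sum[of N] sum_distrib_left)
qed

lemma residue_count_vimage:
  assumes "periodic_mod N S"
    and inj: "\<And>x y. [f x = f y] (mod int N) \<Longrightarrow> [x = y] (mod int N)"
  shows "residue_count N (f -` S) = residue_count N S"
proof -
  let ?h = "\<lambda>j. nat (f (int j) mod int N)"
  have int_h: "int (?h j) = f (int j) mod int N" if "j < N" for j
    using that by simp
  have "inj_on ?h {..<N}"
  proof (rule inj_onI)
    fix i j assume ij: "i \<in> {..<N}" "j \<in> {..<N}" "?h i = ?h j"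
    then have "[f (int i) = f (int j)] (mod int N)"
      using int_h by (metis cong_def lessThan_iff)
    then have "[i = j] (mod N)"
      using inj by (simp flip: cong_int_iff)
    with ij show "i = j"
      by (simp add: cong_less_modulus_unique_nat)
  qed
  moreover have "?h ` {..<N} \<subseteq> {..<N}"
    by (auto simp: nat_less_iff)
  ultimately have "bij_betw ?h {..<N} {..<N}"
    by (simp add: bij_betw_def endo_inj_surj)
  then have "residue_count N S = (\<Sum>j<N. of_bool (int (?h j) \<in> S))"
    unfolding residue_count_eq_sum by (rule sum.reindex_bij_betw[symmetric])
  also have "\<dots> = (\<Sum>j<N. of_bool (f (int j) \<in> S))"
  proof (rule sum.cong)
    fix j assume "j \<in> {..<N}"
    then have "int (?h j) \<in> S \<longleftrightarrow> f (int j) \<in> S"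
      by (intro periodic_modD[OF assms(1)]) (simp add: int_h)
    then show "of_bool (int (?h j) \<in> S) = (of_bool (f (int j) \<in> S) :: nat)"
      by (simp only:)
  qed simp
  finally show ?thesis
    by (simp add: residue_count_eq_sum)
qed

lemma residue_count_image_mult:
  assumes "g > 0"
  shows "residue_count (g * N) ((*) (int g) ` S) = residue_count N S"
proof -
  have "{j. j < g * N \<and> int j \<in> (*) (int g) ` S} = (*) g ` {i. i < N \<and> int i \<in> S}"
  proof (intro equalityI subsetI)
    fix j assume j: "j \<in> {j. j < g * N \<and> int j \<in> (*) (int g) ` S}"
    then obtain a where j_eq: "a \<in> S" "int j = int g * a"
      by auto
    then have "int g dvd int j"
      by simp
    then obtain i where "j = g * i"
      by auto
    with j_eq j assms show "j \<in> (*) g ` {i. i < N \<and> int i \<in> S}"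
      by auto
  qed (use assms in auto)
  then show ?thesis
    using assms by (simp add: residue_count_def card_image inj_on_def)
qed

lemma residue_count_UN_disjoint:
  assumes "finite I" and "\<And>i j. i \<in> I \<Longrightarrow> j \<in> I \<Longrightarrow> i \<noteq> j \<Longrightarrow> S i \<inter> S j = {}"
  shows "residue_count N (\<Union>i\<in>I. S i) = (\<Sum>i\<in>I. residue_count N (S i))"
proof -
  have "{j. j < N \<and> int j \<in> (\<Union>i\<in>I. S i)} = (\<Union>i\<in>I. {j. j < N \<and> int j \<in> S i})"
    by auto
  then show ?thesis
    unfolding residue_count_def using assms by (subst card_UN_disjoint[symmetric]) auto
qed

lemma cong_classes_eq_range: "cong_classes m = range (\<lambda>a. {b. [a = b] (mod m)})"
  by (auto simp: cong_classes_def quotient_def Image_def)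

lemma card_cong_classes_subset:
  assumes "periodic_mod N S" and "N > 0"
  shows "card {C \<in> cong_classes (int N). C \<subseteq> S} = residue_count N S"
proof -
  let ?class = "\<lambda>a. {b. [a = b] (mod int N)}"
  have class_eq_iff: "?class a = ?class b \<longleftrightarrow> [a = b] (mod int N)" for a b
    by (auto simp: cong_def)
  have class_subset_iff: "?class a \<subseteq> S \<longleftrightarrow> a \<in> S" for a
    using periodic_modD[OF assms(1), of a] by auto
  have "bij_betw (\<lambda>j. ?class (int j)) {j. j < N \<and> int j \<in> S} {C \<in> cong_classes (int N). C \<subseteq> S}"
  proof (rule bij_betwI')
    fix i j assume "i \<in> {j. j < N \<and> int j \<in> S}" "j \<in> {j. j < N \<and> int j \<in> S}"
    then show "?class (int i) = ?class (int j) \<longleftrightarrow> i = j"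
      unfolding class_eq_iff by (auto simp: cong_int_iff cong_less_modulus_unique_nat)
  next
    fix j assume "j \<in> {j. j < N \<and> int j \<in> S}"
    then show "?class (int j) \<in> {C \<in> cong_classes (int N). C \<subseteq> S}"
      by (simp add: cong_classes_eq_range class_subset_iff)
  next
    fix C assume "C \<in> {C \<in> cong_classes (int N). C \<subseteq> S}"
    then obtain a where C_eq: "C = ?class a" "a \<in> S"
      using class_subset_iff by (auto simp: cong_classes_eq_range)
    let ?j = "nat (a mod int N)"
    have "[a = int ?j] (mod int N)"
      using assms(2) by (simp add: cong_def)
    then have "C = ?class (int ?j)" "int ?j \<in> S"
      using C_eq class_eq_iff periodic_modD[OF assms(1)] by blast+
    moreover have "?j < N"
      using assms(2) by (simp add: nat_less_iff)
    ultimately show "\<exists>j\<in>{j. j < N \<and> int j \<in> S}. C = ?class (int j)"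
      by blast
  qed
  from bij_betw_same_card[OF this] show ?thesis
    by (simp add: residue_count_def)
qed

subsection \<open>Numerators of fractions of given order\<close>

lemma chi_ord_eq_enat_iff:
  "chi_ord x = enat n \<longleftrightarrow> (chi ^^ n) x \<in> \<int> \<and> (\<forall>k<n. (chi ^^ k) x \<notin> \<int>)"
proof
  assume "chi_ord x = enat n"
  then have ex: "\<exists>k. (chi ^^ k) x \<in> \<int>" and "n = (LEAST k. (chi ^^ k) x \<in> \<int>)"
    by (auto simp: chi_ord_def split: if_splits)
  then show "(chi ^^ n) x \<in> \<int> \<and> (\<forall>k<n. (chi ^^ k) x \<notin> \<int>)"
    using LeastI_ex[OF ex] not_less_Least by blast
next
  assume first_integral: "(chi ^^ n) x \<in> \<int> \<and> (\<forall>k<n. (chi ^^ k) x \<notin> \<int>)"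
  then have "(LEAST k. (chi ^^ k) x \<in> \<int>) = n"
    by (intro Least_equality) (auto simp: not_less[symmetric])
  with first_integral show "chi_ord x = enat n"
    by (auto simp: chi_ord_def)
qed

lemma chi_ord_Suc_iff: "chi_ord x = enat (Suc n) \<longleftrightarrow> x \<notin> \<int> \<and> chi_ord (chi x) = enat n"
  unfolding chi_ord_eq_enat_iff
  by (auto simp: less_Suc_eq_0_disj funpow_Suc_right simp del: funpow.simps(2))

definition numerators_of_order :: "nat \<Rightarrow> nat \<Rightarrow> int set" where
  "numerators_of_order n M = {a. chi_ord (of_int a / of_nat M) = enat n}"

lemma A_set_eq_Int_coprime: "A_set n M = numerators_of_order n M \<inter> {a. coprime a (int M)}"
  by (auto simp: A_set_def numerators_of_order_def coprime_iff_gcd_eq_1)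

lemma fraction_in_Ints_iff:
  assumes "M > 0"
  shows "(of_int a / of_nat M :: rat) \<in> \<int> \<longleftrightarrow> int M dvd a"
  using of_int_div_of_int_in_Ints_iff[of a "int M", where ?'a = rat] assms by simp

lemma numerators_of_order_0: "M > 0 \<Longrightarrow> numerators_of_order 0 M = {a. int M dvd a}"
  by (simp add: numerators_of_order_def chi_ord_eq_enat_iff fraction_in_Ints_iff)

lemma numerators_of_order_Suc:
  assumes "M > 0"
  shows "numerators_of_order (Suc n) M =
    {a. \<not> int M dvd a \<and> a * \<lceil>of_int a / of_nat M :: rat\<rceil> \<in> numerators_of_order n M}"
  using assms by (simp add: numerators_of_order_def chi_ord_Suc_iff fraction_in_Ints_iff chi_def)

lemma periodic_numerators_of_order:
  assumes "M > 0"
  shows "periodic_mod (M ^ Suc n) (numerators_of_order n M)"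
proof (induction n)
  case 0
  show ?case
    using assms by (intro periodic_modI) (simp add: numerators_of_order_0 cong_dvd_iff)
next
  case (Suc n)
  show ?case
  proof (rule periodic_modI)
    fix a b assume cong: "[a = b] (mod int (M ^ Suc (Suc n)))"
    let ?ceil = "\<lambda>a. \<lceil>of_int a / of_nat M :: rat\<rceil>"
    obtain t where b_eq: "b = a + int (M ^ Suc (Suc n)) * t"
      using cong cong_iff_lin by blast
    have "(of_int b / of_nat M :: rat) = of_int a / of_nat M + of_int (int (M ^ Suc n) * t)"
      using assms by (simp add: b_eq field_simps)
    then have "?ceil b = ?ceil a + int (M ^ Suc n) * t"
      by (simp only: ceiling_add_of_int)
    then have "[?ceil a = ?ceil b] (mod int (M ^ Suc n))"
      by (simp add: cong_def)
    moreover have "[a = b] (mod int (M ^ Suc n))"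
      using cong by (rule cong_dvd_modulus) simp
    ultimately have "[a * ?ceil a = b * ?ceil b] (mod int (M ^ Suc n))"
      by (intro cong_mult)
    moreover have "int M dvd a \<longleftrightarrow> int M dvd b"
      using cong by (intro cong_dvd_iff) (rule cong_dvd_modulus, auto)
    ultimately show "a \<in> numerators_of_order (Suc n) M \<longleftrightarrow> b \<in> numerators_of_order (Suc n) M"
      using periodic_modD[OF Suc.IH] assms by (simp add: numerators_of_order_Suc)
  qed
qed

lemma periodic_A_set: "M > 0 \<Longrightarrow> periodic_mod (M ^ Suc n) (A_set n M)"
  unfolding A_set_eq_Int_coprime
  by (intro periodic_mod_Int periodic_numerators_of_order periodic_mod_coprime) auto

lemma A_count_eq_residue_count: "M > 0 \<Longrightarrow> A_count n M = residue_count (M ^ Suc n) (A_set n M)"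
  using card_cong_classes_subset[OF periodic_A_set] by (simp add: A_count_def)

lemma A_count_Suc_1: "A_count (Suc n) 1 = 0"
  by (simp add: A_count_eq_residue_count residue_count_def A_set_eq_Int_coprime
      numerators_of_order_Suc)

subsection \<open>The recursion\<close>

lemma gcd_image_A_set:
  assumes "M > 0" "d dvd M" and "a \<in> (*) (int (M div d)) ` A_set n d"
  shows "gcd a (int M) = int (M div d)"
proof -
  obtain b where "b \<in> A_set n d" and a_eq: "a = int (M div d) * b"
    using assms(3) by blast
  then have "gcd b (int d) = 1"
    by (simp add: A_set_def)
  moreover have "int M = int (M div d) * int d"
    using assms(2) by (simp flip: of_nat_mult)
  ultimately show ?thesis
    using gcd_mult_distrib_int[of "int (M div d)" b "int d"] by (simp add: a_eq)
qed

lemma disjoint_image_A_set: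
  assumes "M > 0" "d dvd M" "d' dvd M" "d \<noteq> d'"
  shows "(*) (int (M div d)) ` A_set n d \<inter> (*) (int (M div d')) ` A_set n d' = {}"
proof -
  have "M div d \<noteq> M div d'"
    using assms by (metis dvd_div_eq_0_iff dvd_div_mult_self mult_cancel_left neq0_conv)
  then show ?thesis
    using gcd_image_A_set assms by (metis disjoint_iff of_nat_eq_iff)
qed

lemma mult_div_in_numerators_of_order_iff:
  assumes "M > 0" "d dvd M"
  shows "int (M div d) * b \<in> numerators_of_order n M \<longleftrightarrow> b \<in> numerators_of_order n d"
proof -
  have "(of_int (int (M div d) * b) / of_nat M :: rat) = of_int b / of_nat d"
    using assms by auto
  then show ?thesis
    by (simp only: numerators_of_order_def mem_Collect_eq)
qed

lemma numerators_of_order_eq_UN_A_set: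
  assumes "M > 0"
  shows "numerators_of_order n M = (\<Union>d\<in>{d. d dvd M}. (*) (int (M div d)) ` A_set n d)"
proof (intro equalityI subsetI)
  fix a assume a: "a \<in> numerators_of_order n M"
  obtain g where gcd_eq: "gcd a (int M) = int g"
    using nonneg_int_cases gcd_ge_0_int by metis
  then obtain b d where a_eq: "a = int g * b" and M_eq: "M = g * d"
    by (metis dvdE gcd_dvd1 gcd_dvd2 int_dvd_int_iff)
  have "g > 0"
    using assms M_eq by simp
  have "int g * gcd b (int d) = int g"
    using gcd_eq gcd_mult_distrib_int[of "int g" b "int d"] by (simp add: a_eq M_eq)
  with \<open>g > 0\<close> have "coprime b (int d)"
    by (simp add: coprime_iff_gcd_eq_1)
  moreover have "M div d = g" "d dvd M"
    using assms M_eq by auto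
  ultimately show "a \<in> (\<Union>d\<in>{d. d dvd M}. (*) (int (M div d)) ` A_set n d)"
    using a a_eq mult_div_in_numerators_of_order_iff[OF assms, of d b]
    by (auto simp: A_set_eq_Int_coprime)
qed (use mult_div_in_numerators_of_order_iff[OF assms] in \<open>auto simp: A_set_eq_Int_coprime\<close>)

lemma residue_count_image_A_set:
  assumes "M > 0" "d dvd M"
  shows "residue_count (M ^ Suc n) ((*) (int (M div d)) ` A_set n d) = A_count n d * (M div d) ^ n"
proof -
  obtain g where M_eq: "M = d * g"
    using assms(2) by blast
  then have pos: "d > 0" "g > 0"
    using assms(1) by auto
  have "M ^ Suc n = g * (d ^ Suc n * g ^ n)"
    by (simp add: M_eq power_mult_distrib)
  then have "residue_count (M ^ Suc n) ((*) (int g) ` A_set n d) =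
      residue_count (d ^ Suc n * g ^ n) (A_set n d)"
    using pos by (simp only: residue_count_image_mult)
  also have "\<dots> = g ^ n * A_count n d"
    using pos by (simp only: residue_count_periodic_mult periodic_A_set A_count_eq_residue_count)
  finally show ?thesis
    using pos by (simp add: M_eq)
qed

lemma residue_count_numerators_of_order:
  assumes "M > 0"
  shows "residue_count (M ^ Suc n) (numerators_of_order n M) =
    (\<Sum>d | d dvd M. A_count n d * (M div d) ^ n)"
proof -
  have "residue_count (M ^ Suc n) (numerators_of_order n M) =
      (\<Sum>d | d dvd M. residue_count (M ^ Suc n) ((*) (int (M div d)) ` A_set n d))"
    unfolding numerators_of_order_eq_UN_A_set[OF assms]
    using assms by (intro residue_count_UN_disjoint disjoint_image_A_set) auto
  also have "\<dots> = (\<Sum>d | d dvd M. A_count n d * (M div d) ^ n)"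
    using assms by (intro sum.cong refl residue_count_image_A_set) auto
  finally show ?thesis .
qed

lemma quadratic_inj_mod_power:
  fixes a b k m x y :: int
  assumes "m dvd a" "coprime b m"
    and "[a * x\<^sup>2 + b * x + k = a * y\<^sup>2 + b * y + k] (mod m ^ n)"
  shows "[x = y] (mod m ^ n)"
proof -
  have "(a * x\<^sup>2 + b * x + k) - (a * y\<^sup>2 + b * y + k) = (x - y) * (a * (x + y) + b)"
    by (simp add: algebra_simps power2_eq_square)
  moreover have "coprime (a * (x + y) + b) m"
  proof -
    have "[a * (x + y) + b = b] (mod m)"
      using assms(1) by (simp add: cong_iff_dvd_diff)
    then show ?thesis
      using assms(2) coprime_cong_cong_left by blast
  qed
  then have "coprime (m ^ n) (a * (x + y) + b)"
    by (simp add: coprime_commute)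
  ultimately show ?thesis
    using assms(3) by (simp add: cong_iff_dvd_diff coprime_dvd_mult_left_iff)
qed

lemma mult_add_in_A_set_Suc_iff:
  assumes "M > 1" "s < M"
  shows "c * int M + int s \<in> A_set (Suc n) M \<longleftrightarrow>
    coprime s M \<and> (c * int M + int s) * (c + 1) \<in> numerators_of_order n M"
proof -
  let ?a = "c * int M + int s"
  have "[?a = int s] (mod int M)"
    by (simp add: cong_def)
  then have coprime_iff: "coprime ?a (int M) \<longleftrightarrow> coprime s M"
    using coprime_cong_cong_left coprime_int_iff by blast
  have "\<lceil>of_int ?a / of_nat M :: rat\<rceil> = c + 1" "\<not> int M dvd ?a" if "coprime s M"
  proof -
    have "s > 0"
      using assms that by (auto intro: Nat.gr0I)
    have "(of_int ?a / of_nat M :: rat) = of_int c + of_nat s / of_nat M"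
      using assms by (simp add: field_simps)
    moreover have "0 < (of_nat s / of_nat M :: rat)" "(of_nat s / of_nat M :: rat) < 1"
      using assms \<open>s > 0\<close> by simp_all
    ultimately show "\<lceil>of_int ?a / of_nat M :: rat\<rceil> = c + 1"
      by (intro ceiling_unique) auto
    show "\<not> int M dvd ?a"
      using assms \<open>s > 0\<close> by (simp add: dvd_add_right_iff nat_dvd_not_less)
  qed
  then show ?thesis
    using assms by (auto simp: A_set_eq_Int_coprime numerators_of_order_Suc coprime_iff)
qed

lemma residue_count_A_set_Suc:
  assumes "M > 1" "s < M"
  shows "residue_count (M ^ Suc n) {c. c * int M + int s \<in> A_set (Suc n) M} =
    (if coprime s M then residue_count (M ^ Suc n) (numerators_of_order n M) else 0)"
proof (cases "coprime s M")
  case True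
  let ?f = "\<lambda>c. (c * int M + int s) * (c + 1)"
  have quadratic: "?f c = int M * c\<^sup>2 + (int M + int s) * c + int s" for c
    by (simp add: algebra_simps power2_eq_square)
  have "{c. c * int M + int s \<in> A_set (Suc n) M} = ?f -` numerators_of_order n M"
    using True assms by (auto simp: mult_add_in_A_set_Suc_iff)
  also have "residue_count (M ^ Suc n) \<dots> = residue_count (M ^ Suc n) (numerators_of_order n M)"
  proof (rule residue_count_vimage)
    show "periodic_mod (M ^ Suc n) (numerators_of_order n M)"
      using assms by (intro periodic_numerators_of_order) simp
    have "[int M + int s = int s] (mod int M)"
      by (simp add: cong_def)
    then have unit: "coprime (int M + int s) (int M)"
      using True coprime_cong_cong_left coprime_int_iff by blast
    show "[x = y] (mod int (M ^ Suc n))" if "[?f x = ?f y] (mod int (M ^ Suc n))" for x y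
      using that unfolding quadratic of_nat_power
      by (rule quadratic_inj_mod_power[OF dvd_refl unit])
  qed
  finally show ?thesis
    using True by simp
next
  case False
  with assms show ?thesis
    by (simp add: mult_add_in_A_set_Suc_iff residue_count_def)
qed

lemma totatives_eq_coprime_less: "M > 1 \<Longrightarrow> totatives M = {s. s < M \<and> coprime s M}"
  by (auto simp: in_totatives_iff totatives_less intro!: Nat.gr0I)

lemma A_count_Suc:
  assumes "M > 1"
  shows "A_count (Suc n) M = totient M * residue_count (M ^ Suc n) (numerators_of_order n M)"
proof -
  let ?N = "M ^ Suc n"
  have "A_count (Suc n) M = residue_count (M * ?N) (A_set (Suc n) M)"
    using assms by (simp add: A_count_eq_residue_count)
  also have "\<dots> = (\<Sum>s<M. residue_count ?N {c. c * int M + int s \<in> A_set (Suc n) M})"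
    by (rule residue_count_mult)
  also have "\<dots> = (\<Sum>s<M. if coprime s M then residue_count ?N (numerators_of_order n M) else 0)"
    using assms by (intro sum.cong refl residue_count_A_set_Suc) auto
  also have "\<dots> = (\<Sum>s\<in>totatives M. residue_count ?N (numerators_of_order n M))"
    using assms by (simp add: totatives_eq_coprime_less sum.If_cases Int_def)
  finally show ?thesis
    by (simp add: totient_def)
qed

theorem theorem2p3:
  fixes M n :: nat
  assumes "M \<ge> 1" and "n \<ge> 1" and "M > 1 \<or> n > 1"
  shows "A_count n M = totient M * (\<Sum>d | d dvd M. A_count (n - 1) d * (M div d) ^ (n - 1))"
proof (cases "M > 1")
  case True
  then show ?thesis
    using A_count_Suc[of M "n - 1"] residue_count_numerators_of_order[of M "n - 1"] assms by simp
next
  case False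
  then obtain k where "M = 1" "n = Suc (Suc k)"
    using assms by (auto dest: less_imp_Suc_add)
  then show ?thesis
    using A_count_Suc_1[of k] A_count_Suc_1[of "Suc k"] by simp
qed

end
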